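(* Let $p,q\ge1$, let $C=(C^1,\dots,C^p)\in\mathfrak{so}(q)^p$ be a tuple of linearly independent skew-symmetric matrices, and suppose the Lie group $N_C$ admits a left-invariant metric that is both a Ricci soliton and geodesic flow invariant. Then such a metric is also a Ricci Yang-Mills soliton.
   Context: **The group $N_C$.** Given a tuple $C=(C^1,\dots,C^p)$ of linearly independent elements of $\mathfrak{so}(q)$ (real skew-symmetric $q\times q$ matrices), $\mathfrak N_C$ is the Lie algebra $\mathbb R^q\oplus\mathbb R^p$ with standard basis $e_1,\dots,e_{q+p}$ (declared orthonormal) and bracket $[e_i,e_j]=\sum_k C^k_{ij}e_{q+k}$ for $1\le i,j\le q$, all other brackets of basis vectors being zero. $N_C$ is the simply connected Lie group with Lie algebra $\mathfrak N_C$ and the corresponding left-invariant metric. Conversely, any left-invariant metric on a simply connected 2-step nilpotent Lie group $N$ with $\dim[\mathfrak N,\mathfrak N]=p$ and codimension $q$ arises, up to isometric isomorphism, from some such tuple: choose an orthonormal basis $X_1,\dots,X_q,Z_1,\dots,Z_p$ of $\mathfrak N$ with the $Z_k$ spanning $[\mathfrak N,\mathfrak N]$ and put $C^k_{ij}=c_{ij}^k$ where $[X_i,X_j]=\sum_kc_{ij}^kZ_k$; such a $C$ is called a tuple of structure matrices of the metric. **Ricci soliton.** A metric $h$ with $Rc(h)+\mathcal L_Xh+\mu h=0$ for some vector field $X$ and some $\mu\in\mathbb R$. **Geodesic flow invariant.** $X\in\mathfrak{gl}_q\mathbb R$ acts on $\mathfrak{so}(q)^p$ by $X\cdot C=(XC^1+C^1X^t,\dots,XC^p+C^pX^t)$.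 Put $m_1(C)=-2\sum_\alpha(C^\alpha)^2$ and $m_{SL_q}(C)=m_1(C)-\frac1q\mathrm{tr}(m_1(C))\,Id$. A left-invariant metric with structure matrices $C$ is called geodesic flow invariant if $C$ is a minimal point of the $SL_q\mathbb R$-action, i.e. $m_{SL_q}(C)\cdot C=0$. **Ricci Yang-Mills soliton.** For a simply connected 2-step nilpotent $N$ with left-invariant metric, let $Z=[N,N]$, $\mathfrak Z=\mathrm{Lie}(Z)$, $\mathcal H=\mathfrak Z^\perp$. Then $\pi:N\to M=N/Z$ is a principal bundle with abelian structure group $G\simeq Z$ acting by right multiplication, with Lie algebra $\mathfrak g\simeq\mathfrak Z$ carrying the restricted inner product $k$. The connection $\omega$ is the left-invariant $\mathfrak g$-valued 1-form which vanishes on $\mathcal H$ and is the identification $\mathfrak Z\simeq\mathfrak g$ on $\mathfrak Z$. Its curvature $\Omega=d\omega$ descends to a $\mathfrak g$-valued 2-form $\tilde\Omega$ on $M$. Let $g$ be the induced metric on $M$ and $\tilde\Omega^2_{ij}=\sum g^{kl}k^{\alpha\beta}\tilde\Omega_{\alpha ki}\tilde\Omega_{\beta lj}$ (Greek indices: indices in $\mathfrak g$; Roman indices: indices on $M$). The metric on $N$ is a Ricci Yang-Mills soliton if there are $\lambda\in\mathbb R$ and a vector field $X$ on $M$ with $\tilde\Omega^2-2Rc(g)=\lambda g+\mathcal L_Xg$ and $\Delta_d\tilde\Omega=\mathcal L_X\tilde\Omega$, where $\Delta_d$ is the Hodge Laplacian. *)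

theory Defs
  imports "HOL-Analysis.Analysis"
begin

section \<open>Tensor calculus in one global chart\<close>

text \<open>
  All manifolds below are diffeomorphic to some \<open>real^'n\<close> and are treated in that chart, every
  tangent space being identified with \<open>real^'n\<close>.  A covariant tensor field is a function of a point
  and of tangent vectors; it may take values in a fixed vector space.
\<close>

abbreviation ddir :: "('a::real_normed_vector \<Rightarrow> 'b::real_normed_vector) \<Rightarrow> 'a \<Rightarrow> 'a \<Rightarrow> 'b"
  where "ddir f x u \<equiv> frechet_derivative f (at x) u"

abbreviation e :: "'n \<Rightarrow> real^'n::finite"
  where "e i \<equiv> axis i 1"

primrec C_k :: "nat \<Rightarrow> ('a::real_normed_vector \<Rightarrow> 'b::real_normed_vector) \<Rightarrow> bool" where
  "C_k 0 f \<longleftrightarrow> continuous_on UNIV f"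
| "C_k (Suc k) f \<longleftrightarrow> (\<forall>x. f differentiable at x) \<and> (\<forall>u. C_k k (\<lambda>x. ddir f x u))"

definition smooth :: "('a::real_normed_vector \<Rightarrow> 'b::real_normed_vector) \<Rightarrow> bool"
  where "smooth f \<longleftrightarrow> (\<forall>k. C_k k f)"

type_synonym 'n metric = "real^'n \<Rightarrow> real^'n \<Rightarrow> real^'n \<Rightarrow> real"

definition riemannian_metric :: "'n::finite metric \<Rightarrow> bool" where
  "riemannian_metric g \<longleftrightarrow>
     (\<forall>x. bilinear (g x)) \<and> (\<forall>x u v. g x u v = g x v u) \<and> (\<forall>x u. u \<noteq> 0 \<longrightarrow> g x u u > 0) \<and>
     (\<forall>u v. smooth (\<lambda>x. g x u v))"

text \<open>The components \<open>b\<^sup>i\<^sup>j\<close> of the inverse of the Gram matrix of an inner product \<open>b\<close>.\<close>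

definition inv_gram :: "(real^'n \<Rightarrow> real^'n \<Rightarrow> real) \<Rightarrow> 'n \<Rightarrow> 'n::finite \<Rightarrow> real"
  where "inv_gram b i j = matrix_inv (\<chi> k l. b (e k) (e l)) $ i $ j"

text \<open>\<open>christoffel g x u v\<close> is \<open>\<nabla>\<^sub>u v\<close> at \<open>x\<close>, where \<open>u\<close>, \<open>v\<close> are extended to constant fields.\<close>

definition christoffel :: "'n::finite metric \<Rightarrow> real^'n \<Rightarrow> real^'n \<Rightarrow> real^'n \<Rightarrow> real^'n" where
  "christoffel g x u v = (\<chi> k. (1/2) * (\<Sum>l\<in>UNIV. inv_gram (g x) k l *
     (ddir (\<lambda>y. g y v (e l)) x u + ddir (\<lambda>y. g y u (e l)) x v - ddir (\<lambda>y. g y u v) x (e l))))"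

text \<open>\<open>riemann g x u v w\<close> is \<open>R(u,v)w = \<nabla>\<^sub>u\<nabla>\<^sub>v w - \<nabla>\<^sub>v\<nabla>\<^sub>u w - \<nabla>\<^bsub>[u,v]\<^esub> w\<close>.\<close>

definition riemann ::
  "'n::finite metric \<Rightarrow> real^'n \<Rightarrow> real^'n \<Rightarrow> real^'n \<Rightarrow> real^'n \<Rightarrow> real^'n" where
  "riemann g x u v w =
     ddir (\<lambda>y. christoffel g y v w) x u - ddir (\<lambda>y. christoffel g y u w) x v
     + christoffel g x u (christoffel g x v w) - christoffel g x v (christoffel g x u w)"

text \<open>The trace of \<open>u \<mapsto> R(u,v)w\<close> (positive on round spheres).\<close>

definition ricci :: "'n::finite metric \<Rightarrow> real^'n \<Rightarrow> real^'n \<Rightarrow> real^'n \<Rightarrow> real"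
  where "ricci g x v w = (\<Sum>i\<in>UNIV. riemann g x (e i) v w $ i)"

definition lie_deriv :: "(real^'n \<Rightarrow> real^'n) \<Rightarrow> (real^'n \<Rightarrow> real^'n \<Rightarrow> real^'n \<Rightarrow> 'b::real_normed_vector)
    \<Rightarrow> real^'n::finite \<Rightarrow> real^'n \<Rightarrow> real^'n \<Rightarrow> 'b" where
  "lie_deriv X T x u v = ddir (\<lambda>y. T y u v) x (X x) + T x (ddir X x u) v + T x u (ddir X x v)"

definition pullback2 :: "(real^'m \<Rightarrow> real^'n) \<Rightarrow> (real^'n \<Rightarrow> real^'n \<Rightarrow> real^'n \<Rightarrow> 'b)
    \<Rightarrow> real^'m::finite \<Rightarrow> real^'m \<Rightarrow> real^'m \<Rightarrow> 'b" where
  "pullback2 f T x u v = T (f x) (ddir f x u) (ddir f x v)"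

definition ext_d1 :: "(real^'n \<Rightarrow> real^'n \<Rightarrow> 'b::real_normed_vector)
    \<Rightarrow> real^'n::finite \<Rightarrow> real^'n \<Rightarrow> real^'n \<Rightarrow> 'b" where
  "ext_d1 \<alpha> x u v = ddir (\<lambda>y. \<alpha> y v) x u - ddir (\<lambda>y. \<alpha> y u) x v"

definition ext_d2 :: "(real^'n \<Rightarrow> real^'n \<Rightarrow> real^'n \<Rightarrow> 'b::real_normed_vector)
    \<Rightarrow> real^'n::finite \<Rightarrow> real^'n \<Rightarrow> real^'n \<Rightarrow> real^'n \<Rightarrow> 'b" where
  "ext_d2 \<beta> x u v w =
     ddir (\<lambda>y. \<beta> y v w) x u - ddir (\<lambda>y. \<beta> y u w) x v + ddir (\<lambda>y. \<beta> y u v) x w"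

text \<open>
  The codifferential, \<open>(\<delta>\<eta>)(v\<^sub>2,\<dots>) = - \<Sum> g\<^sup>k\<^sup>l (\<nabla>\<^sub>k \<eta>)(e\<^sub>l,v\<^sub>2,\<dots>)\<close>, on 2-forms and on 3-forms.
\<close>

definition nabla2 :: "'n::finite metric \<Rightarrow> (real^'n \<Rightarrow> real^'n \<Rightarrow> real^'n \<Rightarrow> 'b::real_normed_vector)
    \<Rightarrow> real^'n \<Rightarrow> real^'n \<Rightarrow> real^'n \<Rightarrow> real^'n \<Rightarrow> 'b" where
  "nabla2 g \<beta> x w u v = ddir (\<lambda>y. \<beta> y u v) x w
     - \<beta> x (christoffel g x w u) v - \<beta> x u (christoffel g x w v)"

definition nabla3 :: "'n::finite metric
    \<Rightarrow> (real^'n \<Rightarrow> real^'n \<Rightarrow> real^'n \<Rightarrow> real^'n \<Rightarrow> 'b::real_normed_vector)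
    \<Rightarrow> real^'n \<Rightarrow> real^'n \<Rightarrow> real^'n \<Rightarrow> real^'n \<Rightarrow> real^'n \<Rightarrow> 'b" where
  "nabla3 g \<gamma> x w t u v = ddir (\<lambda>y. \<gamma> y t u v) x w
     - \<gamma> x (christoffel g x w t) u v - \<gamma> x t (christoffel g x w u) v
     - \<gamma> x t u (christoffel g x w v)"

definition codiff2 :: "'n::finite metric \<Rightarrow> (real^'n \<Rightarrow> real^'n \<Rightarrow> real^'n \<Rightarrow> 'b::real_normed_vector)
    \<Rightarrow> real^'n \<Rightarrow> real^'n \<Rightarrow> 'b" where
  "codiff2 g \<beta> x v =
     - (\<Sum>k\<in>UNIV. \<Sum>l\<in>UNIV. inv_gram (g x) k l *\<^sub>R nabla2 g \<beta> x (e k) (e l) v)"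

definition codiff3 :: "'n::finite metric
    \<Rightarrow> (real^'n \<Rightarrow> real^'n \<Rightarrow> real^'n \<Rightarrow> real^'n \<Rightarrow> 'b::real_normed_vector)
    \<Rightarrow> real^'n \<Rightarrow> real^'n \<Rightarrow> real^'n \<Rightarrow> 'b" where
  "codiff3 g \<gamma> x u v =
     - (\<Sum>k\<in>UNIV. \<Sum>l\<in>UNIV. inv_gram (g x) k l *\<^sub>R nabla3 g \<gamma> x (e k) (e l) u v)"

text \<open>Sign convention: \<open>d\<delta> + \<delta>d\<close>, the nonnegative Laplacian.\<close>

definition hodge_laplacian2 ::
  "'n::finite metric \<Rightarrow> (real^'n \<Rightarrow> real^'n \<Rightarrow> real^'n \<Rightarrow> 'b::real_normed_vector)
    \<Rightarrow> real^'n \<Rightarrow> real^'n \<Rightarrow> real^'n \<Rightarrow> 'b" where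
  "hodge_laplacian2 g \<beta> x u v = ext_d1 (codiff2 g \<beta>) x u v + codiff3 g (ext_d2 \<beta>) x u v"

definition ricci_soliton :: "'n::finite metric \<Rightarrow> bool" where
  "ricci_soliton h \<longleftrightarrow> (\<exists>X \<mu>. smooth X \<and>
     (\<forall>x u v. ricci h x u v + lie_deriv X h x u v + \<mu> * h x u v = 0))"

section \<open>The group \<open>N\<^sub>C\<close>\<close>

text \<open>
  The Lie algebra \<open>\<real>\<^sup>q \<oplus> \<real>\<^sup>p\<close> is \<open>real^('q + 'p)\<close>: the basis vectors \<open>e\<^sub>i\<close>, \<open>i \<le> q\<close>, are \<open>e (Inl i)\<close>
  and the \<open>e\<^bsub>q+k\<^esub>\<close> are \<open>e (Inr k)\<close>.
\<close>

definition nil_bracket ::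
  "('p \<Rightarrow> real^'q^'q) \<Rightarrow> real^('q + 'p) \<Rightarrow> real^('q + 'p) \<Rightarrow> real^('q::finite + 'p::finite)" where
  "nil_bracket C u v = (\<chi> s. case s of Inl i \<Rightarrow> 0
     | Inr k \<Rightarrow> (\<Sum>i\<in>UNIV. \<Sum>j\<in>UNIV. u $ Inl i * v $ Inl j * C k $ i $ j))"

text \<open>
  The simply connected group in exponential coordinates: by Baker-Campbell-Hausdorff, the product
  of a 2-step nilpotent group is \<open>a + b + [a,b]/2\<close>, the neutral element is \<open>0\<close> and the inverse of \<open>a\<close>
  is \<open>-a\<close>.
\<close>

definition nil_mult ::
  "('p \<Rightarrow> real^'q^'q) \<Rightarrow> real^('q + 'p) \<Rightarrow> real^('q + 'p) \<Rightarrow> real^('q::finite + 'p::finite)" where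
  "nil_mult C a b = a + b + (1/2) *\<^sub>R nil_bracket C a b"

definition left_invariant_metric ::
  "('p \<Rightarrow> real^'q^'q) \<Rightarrow> ('q::finite + 'p::finite) metric \<Rightarrow> bool" where
  "left_invariant_metric C h \<longleftrightarrow>
     riemannian_metric h \<and> (\<forall>a. pullback2 (nil_mult C a) h = h)"

text \<open>
  \<open>[\<NN>,\<NN>] = \<ZZ>\<close>, where the Lie algebra \<open>\<NN>\<close> is the tangent space at \<open>0\<close>.
  As the exponential map is the identity here, this is also the commutator subgroup \<open>Z = [N,N]\<close>.
\<close>

definition derived_algebra :: "('p \<Rightarrow> real^'q^'q) \<Rightarrow> (real^('q::finite + 'p::finite)) set"
  where "derived_algebra C = span {nil_bracket C u v |u v. True}"

section \<open>Geodesic flow invariant metrics\<close>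

definition gl_act :: "real^'q^'q \<Rightarrow> ('p \<Rightarrow> real^'q^'q) \<Rightarrow> 'p \<Rightarrow> real^'q^'q::finite"
  where "gl_act X C = (\<lambda>k. X ** C k + C k ** transpose X)"

definition m_1 :: "('p::finite \<Rightarrow> real^'q^'q) \<Rightarrow> real^'q^'q::finite"
  where "m_1 C = (-2) *\<^sub>R (\<Sum>\<alpha>\<in>UNIV. C \<alpha> ** C \<alpha>)"

definition m_SL :: "('p::finite \<Rightarrow> real^'q^'q) \<Rightarrow> real^'q^'q::finite"
  where "m_SL C = m_1 C - (1 / real CARD('q) * trace (m_1 C)) *\<^sub>R mat 1"

definition minimal_point :: "('p::finite \<Rightarrow> real^'q^'q::finite) \<Rightarrow> bool"
  where "minimal_point C \<longleftrightarrow> gl_act (m_SL C) C = (\<lambda>k. 0)"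

text \<open>\<open>B\<close> is a tuple of structure matrices of the left-invariant metric \<open>h\<close> on \<open>N\<^sub>C\<close>.\<close>

definition structure_matrices ::
  "('p \<Rightarrow> real^'q^'q) \<Rightarrow> ('q::finite + 'p::finite) metric \<Rightarrow> ('p \<Rightarrow> real^'q^'q) \<Rightarrow> bool" where
  "structure_matrices C h B \<longleftrightarrow> (\<exists>X :: 'q \<Rightarrow> real^('q + 'p). \<exists>Z :: 'p \<Rightarrow> real^('q + 'p).
     (\<forall>i j. h 0 (X i) (X j) = (if i = j then 1 else 0)) \<and>
     (\<forall>k l. h 0 (Z k) (Z l) = (if k = l then 1 else 0)) \<and>
     (\<forall>i k. h 0 (X i) (Z k) = 0) \<and>
     span (range Z) = derived_algebra C \<and>
     (\<forall>i j. nil_bracket C (X i) (X j) = (\<Sum>k\<in>UNIV. B k $ i $ j *\<^sub>R Z k)))"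

text \<open>
  Two tuples of structure matrices of the same metric differ by an element of \<open>O(q) \<times> O(p)\<close>, which
  preserves minimality, so it does not matter which one is used.
\<close>

definition geodesic_flow_invariant ::
  "('p \<Rightarrow> real^'q^'q) \<Rightarrow> ('q::finite + 'p::finite) metric \<Rightarrow> bool" where
  "geodesic_flow_invariant C h \<longleftrightarrow> (\<exists>B. structure_matrices C h B \<and> minimal_point B)"

section \<open>Ricci Yang-Mills solitons\<close>

text \<open>
  If \<open>C\<close> is linearly independent then \<open>Z = 0 \<oplus> \<real>\<^sup>p\<close> (lemma \<open>derived_algebra_eq\<close>), so that \<open>M = N/Z\<close> is
  \<open>real^'q\<close> with the projection below, and \<open>\<gg> \<simeq> \<ZZ>\<close> is \<open>real^'p\<close> with the identification below.
\<close>

definition nil_proj :: "real^('q::finite + 'p::finite) \<Rightarrow> real^'q" where "nil_proj a = (\<chi> i. a $ Inl i)"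

definition incl :: "real^'p \<Rightarrow> real^('q::finite + 'p::finite)"
  where "incl w = (\<chi> s. case s of Inl i \<Rightarrow> 0 | Inr k \<Rightarrow> w $ k)"

definition horizontal ::
  "('p \<Rightarrow> real^'q^'q) \<Rightarrow> ('q + 'p) metric \<Rightarrow> (real^('q::finite + 'p::finite)) set" where
  "horizontal C h = {u. \<forall>z\<in>derived_algebra C. h 0 u z = 0}"

definition fibre_ip :: "('q::finite + 'p::finite) metric \<Rightarrow> real^'p \<Rightarrow> real^'p \<Rightarrow> real"
  where "fibre_ip h w w' = h 0 (incl w) (incl w')"

definition is_connection_form ::
  "('p \<Rightarrow> real^'q^'q) \<Rightarrow> ('q + 'p) metric \<Rightarrow>
    (real^('q::finite + 'p::finite) \<Rightarrow> real^('q + 'p) \<Rightarrow> real^'p) \<Rightarrow> bool" where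
  "is_connection_form C h \<omega> \<longleftrightarrow>
     (\<forall>x. linear (\<omega> x)) \<and>
     (\<forall>a x u. \<omega> (nil_mult C a x) (ddir (nil_mult C a) x u) = \<omega> x u) \<and>
     (\<forall>u\<in>horizontal C h. \<omega> 0 u = 0) \<and>
     (\<forall>w. \<omega> 0 (incl w) = w)"

text \<open>\<open>\<pi>\<close> is a Riemannian submersion; the horizontal space at \<open>x\<close> is the left translate of \<open>\<H>\<close>.\<close>

definition is_induced_metric ::
  "('p \<Rightarrow> real^'q^'q) \<Rightarrow> ('q::finite + 'p::finite) metric \<Rightarrow> 'q metric \<Rightarrow> bool" where
  "is_induced_metric C h g \<longleftrightarrow> riemannian_metric g \<and>
     (\<forall>x. \<forall>u \<in> ddir (nil_mult C x) 0 ` horizontal C h. \<forall>v \<in> ddir (nil_mult C x) 0 ` horizontal C h.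
        pullback2 nil_proj g x u v = h x u v)"

text \<open>
  \<open>\<Sum> g\<^sup>k\<^sup>l k\<^sup>\<alpha>\<^sup>\<beta> \<Omega>\<^bsub>\<alpha>ki\<^esub> \<Omega>\<^bsub>\<beta>lj\<^esub>\<close> as a bilinear form (\<open>u = e\<^sub>i\<close>, \<open>v = e\<^sub>j\<close>), for the inner product \<open>k\<close> on \<open>\<gg>\<close>;
  the index in \<open>\<gg>\<close> of the \<open>\<gg>\<close>-valued form \<open>\<Omega>\<close> is lowered with \<open>k\<close>.
\<close>

definition curvature_sq ::
  "'q::finite metric \<Rightarrow> (real^'p \<Rightarrow> real^'p \<Rightarrow> real) \<Rightarrow> (real^'q \<Rightarrow> real^'q \<Rightarrow> real^'q \<Rightarrow> real^'p::finite)
    \<Rightarrow> real^'q \<Rightarrow> real^'q \<Rightarrow> real^'q \<Rightarrow> real" where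
  "curvature_sq g b \<Omega> x u v = (\<Sum>k\<in>UNIV. \<Sum>l\<in>UNIV. \<Sum>\<alpha>\<in>UNIV. \<Sum>\<beta>\<in>UNIV.
     inv_gram (g x) k l * inv_gram b \<alpha> \<beta> * b (e \<alpha>) (\<Omega> x (e k) u) * b (e \<beta>) (\<Omega> x (e l) v))"

text \<open>
  For a left-invariant \<open>h\<close> and linearly independent \<open>C\<close>, the data \<open>\<omega>\<close>, \<open>\<Omega>\<close> (the form on \<open>M\<close> to which
  the curvature descends) and \<open>g\<close> exist and are unique.
\<close>

definition ricci_yang_mills_soliton ::
  "('p \<Rightarrow> real^'q^'q) \<Rightarrow> ('q::finite + 'p::finite) metric \<Rightarrow> bool" where
  "ricci_yang_mills_soliton C h \<longleftrightarrow> (\<exists>\<omega> \<Omega> g.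
     is_connection_form C h \<omega> \<and>
     pullback2 nil_proj \<Omega> = ext_d1 \<omega> \<and>
     is_induced_metric C h g \<and>
     (\<exists>c X. smooth X \<and>
        (\<forall>x u v. curvature_sq g (fibre_ip h) \<Omega> x u v - 2 * ricci g x u v
                   = c * g x u v + lie_deriv X g x u v) \<and>
        hodge_laplacian2 g \<Omega> = lie_deriv X \<Omega>))"

section \<open>The coordinate model\<close>

lemma nil_bracket_Inl [simp]: "nil_bracket C u v $ Inl i = 0"
  by (simp add: nil_bracket_def)

lemma nil_bracket_Inr:
  "nil_bracket C u v $ Inr k = (\<Sum>i\<in>UNIV. \<Sum>j\<in>UNIV. u $ Inl i * v $ Inl j * C k $ i $ j)"
  by (simp add: nil_bracket_def)

lemma nil_bracket_cong:
  assumes "\<And>i. u $ Inl i = u' $ Inl i" "\<And>i. v $ Inl i = v' $ Inl i"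
  shows "nil_bracket C u v = nil_bracket C u' v'"
  by (auto simp: vec_eq_iff nil_bracket_def assms split: sum.split)

lemma bilinear_nil_bracket: "bilinear (nil_bracket C)"
proof -
  have "nil_bracket C (u + u') v = nil_bracket C u v + nil_bracket C u' v"
    "nil_bracket C u (v + v') = nil_bracket C u v + nil_bracket C u v'"
    "nil_bracket C (r *\<^sub>R u) v = r *\<^sub>R nil_bracket C u v"
    "nil_bracket C u (r *\<^sub>R v) = r *\<^sub>R nil_bracket C u v" for u u' v v' r
    by (auto simp: vec_eq_iff nil_bracket_def sum.distrib sum_distrib_left algebra_simps
        split: sum.split)
  then show ?thesis
    by (simp add: bilinear_def linear_iff)
qed

lemma nil_bracket_skew:
  assumes "\<forall>k. transpose (C k) = - C k"
  shows "nil_bracket C v u = - nil_bracket C u v"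
proof -
  have *: "C k $ j $ i = - C k $ i $ j" for i j k
  proof -
    have "transpose (C k) $ i $ j = (- C k) $ i $ j" using assms by simp
    then show ?thesis by (simp add: transpose_def)
  qed
  have "(\<Sum>i\<in>UNIV. \<Sum>j\<in>UNIV. v $ Inl i * u $ Inl j * C k $ i $ j) =
        - (\<Sum>i\<in>UNIV. \<Sum>j\<in>UNIV. u $ Inl i * v $ Inl j * C k $ i $ j)" for k
  proof -
    have "v $ Inl i * u $ Inl j * C k $ i $ j = - (u $ Inl j * v $ Inl i * C k $ j $ i)" for i j
      by (subst *[of k i j]) (simp add: mult.commute)
    then show ?thesis
      by (subst sum.swap) (simp add: sum_negf)
  qed
  then show ?thesis
    by (auto simp: vec_eq_iff nil_bracket_def split: sum.split)
qed

lemma nil_bracket_nilpotent [simp]: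
  "nil_bracket C (nil_bracket C u v) w = 0" "nil_bracket C w (nil_bracket C u v) = 0"
  by (auto simp: vec_eq_iff nil_bracket_def split: sum.split)

lemma nil_mult_assoc: "nil_mult C (nil_mult C a b) c = nil_mult C a (nil_mult C b c)"
  by (simp add: nil_mult_def bilinear_ladd[OF bilinear_nil_bracket]
      bilinear_radd[OF bilinear_nil_bracket] bilinear_lmul[OF bilinear_nil_bracket]
      bilinear_rmul[OF bilinear_nil_bracket] algebra_simps)

lemma nil_mult_zero: "nil_mult C 0 a = a" "nil_mult C a 0 = a"
  by (simp_all add: nil_mult_def bilinear_lzero[OF bilinear_nil_bracket]
      bilinear_rzero[OF bilinear_nil_bracket])

lemma nil_mult_inverse:
  assumes "\<forall>k. transpose (C k) = - C k"
  shows "nil_mult C (- a) a = 0" "nil_mult C a (- a) = 0"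
proof -
  have "nil_bracket C a a = - nil_bracket C a a"
    by (rule nil_bracket_skew[OF assms])
  then have "nil_bracket C a a = 0"
    by (simp add: eq_neg_iff_add_eq_0 flip: scaleR_2)
  then show "nil_mult C (- a) a = 0" "nil_mult C a (- a) = 0"
    by (simp_all add: nil_mult_def bilinear_lneg[OF bilinear_nil_bracket]
        bilinear_rneg[OF bilinear_nil_bracket])
qed

lemma nil_mult_commutator:
  assumes "\<forall>k. transpose (C k) = - C k"
  shows "nil_mult C a b = nil_mult C (nil_bracket C a b) (nil_mult C b a)"
proof -
  have "nil_bracket C (nil_bracket C a b) (nil_mult C b a) = 0" by simp
  moreover have "nil_bracket C a b = (1/2) *\<^sub>R nil_bracket C a b + (1/2) *\<^sub>R nil_bracket C a b"
    by (metis scaleR_half_double scaleR_right_distrib)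
  ultimately show ?thesis
    by (simp add: nil_mult_def nil_bracket_skew[OF assms, of b a])
qed

lemma nil_proj_mult: "nil_proj (nil_mult C a b) = nil_proj a + nil_proj b"
  by (simp add: nil_proj_def nil_mult_def vec_eq_iff)

text \<open>
  The bracket of the left-invariant fields extending \<open>u\<close> and \<open>v\<close> is the one extending
  \<open>nil_bracket C u v\<close>, so the group has Lie algebra \<open>\<NN>\<^sub>C\<close>.
\<close>

lemma nil_mult_has_derivative:
  "(nil_mult C a has_derivative (\<lambda>u. u + (1/2) *\<^sub>R nil_bracket C a u)) (at x)"
proof -
  have "bounded_linear (nil_bracket C a)"
    using bilinear_nil_bracket by (auto simp: bilinear_def linear_conv_bounded_linear)
  then have "(nil_bracket C a has_derivative nil_bracket C a) (at x)"
    by (rule bounded_linear_imp_has_derivative)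
  then show ?thesis
    unfolding nil_mult_def [abs_def] by (auto intro!: derivative_eq_intros)
qed

lemma ddir_nil_mult: "ddir (nil_mult C a) x u = u + (1/2) *\<^sub>R nil_bracket C a u"
  by (rule fun_cong[OF frechet_derivative_at[OF nil_mult_has_derivative, symmetric]])

lemma left_invariant_bracket:
  assumes "\<forall>k. transpose (C k) = - C k"
  defines "L \<equiv> \<lambda>u a. ddir (nil_mult C a) 0 u"
  shows "ddir (L v) a (L u a) - ddir (L u) a (L v a) = L (nil_bracket C u v) a"
proof -
  have L: "L u = (\<lambda>a. u + (1/2) *\<^sub>R nil_bracket C a u)" for u
    by (simp add: L_def ddir_nil_mult fun_eq_iff)
  have "(L u has_derivative (\<lambda>w. (1/2) *\<^sub>R nil_bracket C w u)) (at a)" for u a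
  proof -
    have "bounded_linear (\<lambda>w. nil_bracket C w u)"
      using bilinear_nil_bracket by (auto simp: bilinear_def linear_conv_bounded_linear)
    then have "((\<lambda>w. nil_bracket C w u) has_derivative (\<lambda>w. nil_bracket C w u)) (at a)"
      by (rule bounded_linear_imp_has_derivative)
    then show ?thesis unfolding L by (auto intro!: derivative_eq_intros)
  qed
  then have D: "ddir (L u) a w = (1/2) *\<^sub>R nil_bracket C w u" for u a w
    by (rule fun_cong[OF frechet_derivative_at[symmetric]])
  have E: "nil_bracket C (L u a) v = nil_bracket C u v" for u v
    by (rule nil_bracket_cong) (simp_all add: L)
  have half: "(1/2) *\<^sub>R z + (1/2) *\<^sub>R z = z" for z :: "real^('a + 'b)"
    by (metis scaleR_half_double scaleR_right_distrib)
  show ?thesis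
    by (simp add: D E nil_bracket_skew[OF assms(1), of v u] half) (simp add: L)
qed

text \<open>The kernel of the projection is the derived algebra, respectively the commutator subgroup.\<close>

lemma derived_algebra_eq:
  fixes C :: "'p::finite \<Rightarrow> real^'q^'q::finite"
  assumes "inj C" "independent (range C)"
  shows "derived_algebra C = {a. nil_proj a = 0}" "derived_algebra C = range incl"
proof -
  let ?B = "{nil_bracket C u v |u v. True}"
  have 1: "derived_algebra C \<subseteq> {a. nil_proj a = 0}"
    unfolding derived_algebra_def
    by (rule span_minimal) (auto simp: nil_proj_def vec_eq_iff subspace_def)
  have 2: "{a. nil_proj a = 0} \<subseteq> range (incl :: real^'p \<Rightarrow> real^('q + 'p))"
  proof
    fix a :: "real^('q + 'p)" assume "a \<in> {a. nil_proj a = 0}"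
    then have "a = incl (\<chi> k. a $ Inr k)"
      by (auto simp: nil_proj_def incl_def vec_eq_iff split: sum.split)
    then show "a \<in> range incl" by blast
  qed
  have 3: "range incl \<subseteq> derived_algebra C"
  proof (rule ccontr)
    assume "\<not> ?thesis"
    then obtain w where w: "incl w \<notin> derived_algebra C" by auto
    obtain y z where yz: "y \<in> span ?B" "\<And>b. b \<in> span ?B \<Longrightarrow> orthogonal z b" "incl w = y + z"
      by (rule orthogonal_subspace_decomp_exists[of ?B "incl w"]) blast
    have zl: "z $ Inl i = 0" for i
    proof -
      have "y $ Inl i = 0"
        using 1 yz(1) by (auto simp: derived_algebra_def nil_proj_def vec_eq_iff)
      moreover have "y $ Inl i + z $ Inl i = 0"
        by (simp add: incl_def flip: vector_add_component yz(3))
      ultimately show ?thesis by simp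
    qed
    have inner: "(\<Sum>k\<in>UNIV. z $ Inr k * b $ Inr k) = 0" if "b \<in> ?B" for b
    proof -
      have "z \<bullet> b = 0" using yz(2)[OF span_base[OF that]] by (simp add: orthogonal_def)
      moreover have "z \<bullet> b = (\<Sum>i\<in>UNIV. z $ Inl i * b $ Inl i) + (\<Sum>k\<in>UNIV. z $ Inr k * b $ Inr k)"
        by (simp add: inner_vec_def UNIV_sum sum.Plus[unfolded Plus_def] )
      ultimately show ?thesis by (simp add: zl)
    qed
    have "(\<Sum>k\<in>UNIV. z $ Inr k *\<^sub>R C k) = 0"
    proof -
      have "(\<Sum>k\<in>UNIV. z $ Inr k * C k $ i $ j) = 0" for i j
      proof -
        have "nil_bracket C (e (Inl i)) (e (Inl j)) $ Inr k = C k $ i $ j" for k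
          by (simp add: nil_bracket_Inr axis_def if_distrib[of "\<lambda>t. t * _"] if_distrib[of "\<lambda>t. _ * t"] 
              sum.delta' sum.delta cong: if_cong)
        then show ?thesis using inner[of "nil_bracket C (e (Inl i)) (e (Inl j))"] by auto
      qed
      then show ?thesis by (simp add: vec_eq_iff)
    qed
    also have "(\<Sum>k\<in>UNIV. z $ Inr k *\<^sub>R C k) = (\<Sum>A\<in>range C. z $ Inr (inv C A) *\<^sub>R A)"
      using assms(1) by (simp add: sum.reindex)
    finally have "\<forall>A\<in>range C. z $ Inr (inv C A) = 0"
      using independentD[OF assms(2), of "range C" "\<lambda>A. z $ Inr (inv C A)"] by auto
    then have "z $ Inr k = 0" for k using assms(1) by auto
    then have "z = 0" using zl by (metis (full_types) sum.exhaust vec_eq_iff zero_index)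
    then show False using w yz by (simp add: derived_algebra_def)
  qed
  have 4: "range (incl :: real^'p \<Rightarrow> real^('q + 'p)) \<subseteq> {a. nil_proj a = 0}"
    by (auto simp: nil_proj_def incl_def vec_eq_iff)
  show "derived_algebra C = {a. nil_proj a = 0}" "derived_algebra C = range incl"
    using 1 2 3 4 by blast+
qed

end

theory Submission
  imports Defs
begin

text \<open>
  The induced metric on \<open>M\<close> is flat and the curvature has constant coefficients, so \<open>Rc(g) = 0\<close> and
  the Hodge Laplacian of the curvature vanishes, while the squared curvature is \<open>m\<^sub>1(B)/2\<close> in an
  orthonormal frame with structure matrices \<open>B\<close>.  The linear vector field given in that frame by
  \<open>m_SL B / 4\<close> thus solves the first soliton equation with constant \<open>tr(m\<^sub>1(B)) / 2q\<close>, and minimality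
  of \<open>B\<close> says exactly that its flow preserves the curvature, which is the second equation.
\<close>

section \<open>Constant tensor fields\<close>

lemma C_k_const: "C_k k (\<lambda>x. c)"
  by (induction k arbitrary: c) (simp_all add: frechet_derivative_const)

lemma smooth_const: "smooth (\<lambda>x. c)"
  by (simp add: smooth_def C_k_const)

lemma ddir_linear:
  fixes f :: "'a::euclidean_space \<Rightarrow> 'b::real_normed_vector"
  assumes "linear f"
  shows "ddir f x u = f u"
  by (rule fun_cong[OF frechet_derivative_at[symmetric]])
    (simp add: assms linear_conv_bounded_linear[symmetric] bounded_linear_imp_has_derivative)

lemma smooth_linear:
  fixes f :: "'a::euclidean_space \<Rightarrow> 'b::real_normed_vector"
  assumes "linear f"
  shows "smooth f"
proof -
  have "f differentiable at x" for x
    using assms by (simp add: linear_imp_differentiable)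
  moreover have "continuous_on UNIV f"
    using assms by (simp add: linear_continuous_on linear_conv_bounded_linear[symmetric])
  ultimately have "C_k k f" for k
    by (cases k) (simp_all add: ddir_linear[OF assms] C_k_const)
  then show ?thesis by (simp add: smooth_def)
qed

lemma christoffel_const: "christoffel (\<lambda>x. b) x u v = 0"
  by (simp add: christoffel_def frechet_derivative_const vec_eq_iff)

lemma ricci_const: "ricci (\<lambda>x. b) x u v = 0"
  by (simp add: ricci_def riemann_def christoffel_const frechet_derivative_const)

text \<open>For a constant metric the Christoffel symbols vanish, so covariant derivatives reduce to
  partial ones, and these vanish on constant forms. Bilinearity gives
  \<open>\<beta> 0 v = \<beta> u 0 = 0\<close> in the correction terms of
  \<open>nabla2\<close>.\<close>

lemma hodge_laplacian2_const:
  assumes "bilinear \<beta>"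
  shows "hodge_laplacian2 (\<lambda>x. b) (\<lambda>x. \<beta>) x u v = 0"
proof -
  have "codiff2 (\<lambda>x. b) (\<lambda>x. \<beta>) x w = 0" for x w
    by (simp add: codiff2_def nabla2_def christoffel_const frechet_derivative_const
        bilinear_lzero[OF assms] bilinear_rzero[OF assms])
  moreover have "ext_d2 (\<lambda>x. \<beta>) x t u v = 0" for x t u v
    by (simp add: ext_d2_def frechet_derivative_const)
  ultimately show ?thesis
    by (simp add: hodge_laplacian2_def ext_d1_def codiff3_def nabla3_def frechet_derivative_const)
qed

text \<open>A linear field is its own derivative, so what remains is the infinitesimal action of
  \<open>X\<close> on the bilinear form \<open>T\<close>.\<close>

lemma lie_deriv_const:
  assumes "linear X"
  shows "lie_deriv X (\<lambda>x. T) x u v = T (X u) v + T u (X v)"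
  by (simp add: lie_deriv_def frechet_derivative_const ddir_linear[OF assms])

section \<open>Orthonormal frames\<close>

lemma bilinear_expand_axis:
  fixes b :: "real^'m::finite \<Rightarrow> real^'n::finite \<Rightarrow> real"
  assumes "bilinear b"
  shows "b u v = (\<Sum>k\<in>UNIV. \<Sum>l\<in>UNIV. u $ k * v $ l * b (e k) (e l))"
proof -
  have "b u v = b (\<Sum>k\<in>UNIV. u $ k *\<^sub>R e k) (\<Sum>l\<in>UNIV. v $ l *\<^sub>R e l)"
    using basis_expansion[of u] basis_expansion[of v] by (simp add: scalar_mult_eq_scaleR)
  also have "\<dots> = (\<Sum>(k,l)\<in>UNIV \<times> UNIV. b (u $ k *\<^sub>R e k) (v $ l *\<^sub>R e l))"
    by (rule bilinear_sum[OF assms])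
  finally show ?thesis
    by (simp add: sum.cartesian_product bilinear_lmul[OF assms] bilinear_rmul[OF assms] mult_ac)
qed

text \<open>With the frame as columns of \<open>F\<close> and the Gram matrix \<open>G\<close>,
  orthonormality reads \<open>F^t G F = 1\<close>. Hence \<open>F^t G\<close> is the inverse of
  \<open>F\<close>, which is the expansion, and \<open>F F^t\<close> is the inverse of
  \<open>G\<close>.\<close>

lemma
  fixes b :: "real^'n::finite \<Rightarrow> real^'n \<Rightarrow> real" and f :: "'n \<Rightarrow> real^'n"
  assumes b: "bilinear b" and f: "\<And>i j. b (f i) (f j) = (if i = j then 1 else 0)"
  shows orthonormal_expansion: "(\<Sum>i\<in>UNIV. b (f i) u *\<^sub>R f i) = u"
    and inv_gram_orthonormal: "inv_gram b k l = (\<Sum>i\<in>UNIV. f i $ k * f i $ l)"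
proof -
  define G F where "G = (\<chi> k l. b (e k) (e l))" and "F = (\<chi> k i. f i $ k)"
  have FGu: "((transpose F ** G) *v u) $ i = b (f i) u" for i u
    by (subst bilinear_expand_axis[OF b], subst sum.swap)
      (simp add: matrix_vector_mult_def matrix_matrix_mult_def transpose_def G_def F_def
        sum_distrib_left sum_distrib_right mult_ac)
  have "((transpose F ** G) ** F) $ i $ j = mat 1 $ i $ j" for i j
  proof -
    have "((transpose F ** G) ** F) $ i $ j = ((transpose F ** G) *v f j) $ i"
      by (simp add: matrix_matrix_mult_def matrix_vector_mult_def F_def)
    then show ?thesis by (simp add: FGu f mat_def)
  qed
  then have "(transpose F ** G) ** F = mat 1" by (simp add: vec_eq_iff)
  \<comment> \<open>One-sided inverses of square matrices are two-sided; this replaces a separate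
    argument that the frame spans.\<close>
  then have inv: "F ** (transpose F ** G) = mat 1" by (simp add: matrix_left_right_inverse)
  have "u = F *v ((transpose F ** G) *v u)"
    by (simp add: matrix_vector_mul_assoc inv)
  also have "\<dots> = (\<Sum>i\<in>UNIV. b (f i) u *\<^sub>R f i)"
    by (subst vec_eq_iff, subst matrix_vector_mult_def) (simp add: FGu, simp add: F_def mult.commute)
  finally show "(\<Sum>i\<in>UNIV. b (f i) u *\<^sub>R f i) = u" ..
  have left: "(F ** transpose F) ** G = mat 1" using inv by (simp add: matrix_mul_assoc)
  then have right: "G ** (F ** transpose F) = mat 1" by (simp add: matrix_left_right_inverse)
  \<comment> \<open>\<open>matrix_inv\<close> is a choice of some two-sided inverse;
    \<open>F ** transpose F\<close> witnesses that one exists.\<close>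
  have "matrix_inv G ** G = mat 1"
    unfolding matrix_inv_def by (rule someI2[of _ "F ** transpose F"]) (simp_all add: left right)
  then have "matrix_inv G = F ** transpose F"
    by (metis right matrix_mul_assoc matrix_mul_lid matrix_mul_rid)
  then show "inv_gram b k l = (\<Sum>i\<in>UNIV. f i $ k * f i $ l)"
    by (simp add: inv_gram_def G_def[symmetric] matrix_matrix_mult_def transpose_def F_def)
qed

text \<open>Basis independence of the metric trace: the inverse Gram matrix is a sum over frame
  vectors, and expanding \<open>T\<close> in the standard basis produces the same triple
  sum.\<close>

lemma trace_orthonormal:
  fixes b T :: "real^'n::finite \<Rightarrow> real^'n \<Rightarrow> real" and f :: "'n \<Rightarrow> real^'n"
  assumes b: "bilinear b" and f: "\<And>i j. b (f i) (f j) = (if i = j then 1 else 0)"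
    and T: "bilinear T"
  shows "(\<Sum>k\<in>UNIV. \<Sum>l\<in>UNIV. inv_gram b k l * T (e k) (e l)) = (\<Sum>i\<in>UNIV. T (f i) (f i))"
proof -
  have "(\<Sum>i\<in>UNIV. T (f i) (f i))
      = (\<Sum>i\<in>UNIV. \<Sum>k\<in>UNIV. \<Sum>l\<in>UNIV. f i $ k * f i $ l * T (e k) (e l))"
    using bilinear_expand_axis[OF T] by (intro sum.cong refl) blast
  also have "\<dots> = (\<Sum>k\<in>UNIV. \<Sum>i\<in>UNIV. \<Sum>l\<in>UNIV. f i $ k * f i $ l * T (e k) (e l))"
    by (rule sum.swap)
  also have "\<dots> = (\<Sum>k\<in>UNIV. \<Sum>l\<in>UNIV. \<Sum>i\<in>UNIV. f i $ k * f i $ l * T (e k) (e l))"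
    by (intro sum.cong refl sum.swap)
  finally show ?thesis
    by (simp add: inv_gram_orthonormal[OF b f] sum_distrib_right)
qed

text \<open>Two metric traces in succession, first over the fibre indices (\<open>T1\<close>) and
  then over the base indices (\<open>T2\<close>).\<close>

lemma curvature_sq_orthonormal:
  fixes \<Omega> :: "real^'q::finite \<Rightarrow> real^'q \<Rightarrow> real^'q \<Rightarrow> real^'p::finite"
    and f :: "'q \<Rightarrow> real^'q" and z :: "'p \<Rightarrow> real^'p"
  assumes g: "bilinear (g x)" and f: "\<And>i j. g x (f i) (f j) = (if i = j then 1 else 0)"
    and b: "bilinear b" and z: "\<And>k l. b (z k) (z l) = (if k = l then 1 else 0)"
    and \<Omega>: "bilinear (\<Omega> x)"
  shows "curvature_sq g b \<Omega> x u v
    = (\<Sum>i\<in>UNIV. \<Sum>\<alpha>\<in>UNIV. b (z \<alpha>) (\<Omega> x (f i) u) * b (z \<alpha>) (\<Omega> x (f i) v))"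
proof -
  note lin = bilinear_ladd bilinear_radd bilinear_lmul bilinear_rmul
  have T1: "bilinear (\<lambda>s t. b s w * b t w')" for w w'
    by (auto simp: bilinear_def linear_iff lin[OF b] algebra_simps)
  have T2: "bilinear (\<lambda>s t. b a (\<Omega> x s u) * b a (\<Omega> x t v))" for a
    by (auto simp: bilinear_def linear_iff lin[OF b] lin[OF \<Omega>] algebra_simps)
  have "curvature_sq g b \<Omega> x u v = (\<Sum>k\<in>UNIV. \<Sum>l\<in>UNIV. inv_gram (g x) k l *
      (\<Sum>\<alpha>\<in>UNIV. \<Sum>\<beta>\<in>UNIV. inv_gram b \<alpha> \<beta> * (b (e \<alpha>) (\<Omega> x (e k) u) * b (e \<beta>) (\<Omega> x (e l) v))))"
    by (simp add: curvature_sq_def sum_distrib_left mult_ac)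
  also have "\<dots> = (\<Sum>k\<in>UNIV. \<Sum>l\<in>UNIV. \<Sum>\<alpha>\<in>UNIV.
      inv_gram (g x) k l * (b (z \<alpha>) (\<Omega> x (e k) u) * b (z \<alpha>) (\<Omega> x (e l) v)))"
    by (subst trace_orthonormal[OF b z T1]) (simp add: sum_distrib_left)
  also have "\<dots> = (\<Sum>k\<in>UNIV. \<Sum>\<alpha>\<in>UNIV. \<Sum>l\<in>UNIV.
      inv_gram (g x) k l * (b (z \<alpha>) (\<Omega> x (e k) u) * b (z \<alpha>) (\<Omega> x (e l) v)))"
    by (intro sum.cong refl sum.swap)
  also have "\<dots> = (\<Sum>\<alpha>\<in>UNIV. \<Sum>k\<in>UNIV. \<Sum>l\<in>UNIV.
      inv_gram (g x) k l * (b (z \<alpha>) (\<Omega> x (e k) u) * b (z \<alpha>) (\<Omega> x (e l) v)))"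
    by (rule sum.swap)
  also have "\<dots> = (\<Sum>\<alpha>\<in>UNIV. \<Sum>i\<in>UNIV. b (z \<alpha>) (\<Omega> x (f i) u) * b (z \<alpha>) (\<Omega> x (f i) v))"
    by (intro sum.cong refl trace_orthonormal[OF g f T2])
  also have "\<dots> = (\<Sum>i\<in>UNIV. \<Sum>\<alpha>\<in>UNIV. b (z \<alpha>) (\<Omega> x (f i) u) * b (z \<alpha>) (\<Omega> x (f i) v))"
    by (rule sum.swap)
  finally show ?thesis .
qed

section \<open>The algebra of minimal points\<close>

lemma skew_transpose_square:
  fixes A :: "real^'n::finite^'n"
  assumes "transpose A = - A"
  shows "transpose (A ** A) = A ** A"
  unfolding matrix_transpose_mul assms by (simp add: matrix_matrix_mult_def vec_eq_iff)

lemma uminus_matrix_vector_mult: "(- A) *v x = - (A *v x)" for A :: "real^'n::finite^'m"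
  by (simp add: matrix_vector_mult_def vec_eq_iff sum_negf)

lemma m_1_symmetric:
  assumes "\<And>k. transpose (B k) = - B k"
  shows "transpose (m_1 B) = m_1 B"
proof -
  have "(B k ** B k) $ j $ i = (B k ** B k) $ i $ j" for k i j
    using arg_cong[OF skew_transpose_square[OF assms[of k]], of "\<lambda>A. A $ i $ j"]
    by (simp add: transpose_def)
  then show ?thesis by (simp add: m_1_def transpose_def vec_eq_iff)
qed

lemma m_SL_symmetric:
  assumes "\<And>k. transpose (B k) = - B k"
  shows "transpose (m_SL B) = m_SL B"
proof -
  have "m_1 B $ j $ i = m_1 B $ i $ j" for i j
    using arg_cong[OF m_1_symmetric[OF assms], of "\<lambda>A. A $ i $ j"] by (simp add: transpose_def)
  then show ?thesis by (simp add: m_SL_def transpose_def mat_def vec_eq_iff)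
qed

text \<open>Moving one skew factor across the inner product costs a sign, so \<open>m_1\<close> is
  twice the sum of the products of \<open>B k\<close> with its transpose. This is the form in which
  the squared curvature appears.\<close>

lemma inner_m_1:
  assumes "\<And>k. transpose (B k) = - B k"
  shows "a \<bullet> (m_1 B *v c) = 2 * (\<Sum>k\<in>UNIV. (B k *v a) \<bullet> (B k *v c))"
proof -
  have "(B k *v a) \<bullet> (B k *v c) = - (a \<bullet> ((B k ** B k) *v c))" for k
  proof -
    have "B k *v a = - (a v* B k)"
      using transpose_matrix_vector[of "B k" a]
      by (metis assms minus_minus uminus_matrix_vector_mult)
    then have "(B k *v a) \<bullet> (B k *v c) = - (a \<bullet> (B k *v (B k *v c)))"
      by (simp add: dot_lmul_matrix)
    then show ?thesis by (simp add: matrix_vector_mul_assoc)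
  qed
  moreover have "(\<Sum>k\<in>UNIV. B k ** B k) *v c = (\<Sum>k\<in>UNIV. (B k ** B k) *v c)"
    by (induction rule: infinite_finite_induct[of _ UNIV]) (auto simp: matrix_vector_mult_add_rdistrib)
  ultimately show ?thesis
    by (simp add: m_1_def scaleR_matrix_vector_assoc[symmetric] uminus_matrix_vector_mult
        inner_sum_right sum_negf)
qed

text \<open>Since \<open>m_SL B\<close> is symmetric, minimality says that it anticommutes with each
  \<open>B k\<close>. The left side is the infinitesimal action of \<open>m_SL B\<close> on the
  bilinear form with matrix \<open>B k\<close>.\<close>

lemma minimal_point_m_SL:
  assumes "\<And>k. transpose (B k) = - B k" and "minimal_point B"
  shows "(m_SL B *v a) \<bullet> (B k *v c) + a \<bullet> (B k *v (m_SL B *v c)) = 0"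
proof -
  have "m_SL B ** B k + B k ** m_SL B = 0"
    using fun_cong[OF assms(2)[unfolded minimal_point_def], of k]
    by (simp add: gl_act_def m_SL_symmetric[OF assms(1)])
  then have "a \<bullet> ((m_SL B ** B k + B k ** m_SL B) *v c) = 0" by simp
  moreover have "(m_SL B *v a) \<bullet> (B k *v c) = a \<bullet> (m_SL B *v (B k *v c))"
    using dot_lmul_matrix[of a "m_SL B" "B k *v c"] transpose_matrix_vector[of "m_SL B" a]
    by (simp add: m_SL_symmetric[OF assms(1)])
  ultimately show ?thesis
    by (simp add: matrix_vector_mult_add_rdistrib matrix_vector_mul_assoc inner_add_right)
qed

section \<open>Adapted orthonormal frames\<close>

definition vert :: "real^('q::finite + 'p::finite) \<Rightarrow> real^'p"
  where "vert a = (\<chi> k. a $ Inr k)"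

text \<open>A section of \<open>nil_proj\<close> that ignores the metric: its image need not be
  orthogonal to the centre, which \<open>lift\<close> corrects below.\<close>

definition horiz_incl :: "real^'q \<Rightarrow> real^('q::finite + 'p::finite)"
  where "horiz_incl u = (\<chi> s. case s of Inl i \<Rightarrow> u $ i | Inr k \<Rightarrow> 0)"

lemma linear_nil_proj: "linear nil_proj"
  by (auto simp: linear_iff nil_proj_def vec_eq_iff)

lemma linear_vert: "linear vert"
  by (auto simp: linear_iff vert_def vec_eq_iff)

lemma linear_incl: "linear incl"
  by (auto simp: linear_iff incl_def vec_eq_iff split: sum.split)

lemma linear_horiz_incl: "linear horiz_incl"
  by (auto simp: linear_iff horiz_incl_def vec_eq_iff split: sum.split)

lemma vert_incl [simp]: "vert (incl w) = w"
  by (simp add: vert_def incl_def vec_eq_iff)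

lemma nil_proj_incl [simp]: "nil_proj (incl w) = 0"
  by (simp add: nil_proj_def incl_def vec_eq_iff)

lemma nil_proj_horiz_incl [simp]: "nil_proj (horiz_incl u) = u"
  by (simp add: nil_proj_def horiz_incl_def vec_eq_iff)

lemma nil_proj_bracket [simp]: "nil_proj (nil_bracket C u v) = 0"
  by (simp add: nil_proj_def vec_eq_iff)

lemma incl_vert: "nil_proj a = 0 \<Longrightarrow> incl (vert a) = a"
  by (auto simp: nil_proj_def incl_def vert_def vec_eq_iff split: sum.split)

lemma nil_bracket_nil_proj_cong:
  assumes "nil_proj u = nil_proj u'" "nil_proj v = nil_proj v'"
  shows "nil_bracket C u v = nil_bracket C u' v'"
  using assms by (intro nil_bracket_cong) (simp_all add: nil_proj_def vec_eq_iff)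

text \<open>The assumptions on \<open>X\<close>, \<open>Z\<close> and \<open>B\<close> unfold
  \<open>structure_matrices\<close>. Linear independence of \<open>C\<close> enters through
  \<open>derived\<close>, which makes the vertical space the kernel of the projection.\<close>

locale adapted_frame =
  fixes C :: "'p::finite \<Rightarrow> real^'q^'q::finite"
    and h :: "('q + 'p) metric"
    and X :: "'q \<Rightarrow> real^('q + 'p)" and Z :: "'p \<Rightarrow> real^('q + 'p)"
    and B :: "'p \<Rightarrow> real^'q^'q"
  assumes C_skew: "\<forall>k. transpose (C k) = - C k"
    and derived: "derived_algebra C = {a. nil_proj a = 0}"
    and left_inv: "left_invariant_metric C h"
    and XX: "h 0 (X i) (X j) = (if i = j then 1 else 0)"
    and ZZ: "h 0 (Z k) (Z l) = (if k = l then 1 else 0)"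
    and XZ: "h 0 (X i) (Z k) = 0"
    and span_Z: "span (range Z) = derived_algebra C"
    and bracket_X: "nil_bracket C (X i) (X j) = (\<Sum>k\<in>UNIV. B k $ i $ j *\<^sub>R Z k)"
begin

lemma bilinear_h: "bilinear (h 0)"
  and h_sym: "h 0 u v = h 0 v u"
  and h_pos: "u \<noteq> 0 \<Longrightarrow> h 0 u u > 0"
  using left_inv by (auto simp: left_invariant_metric_def riemannian_metric_def)

lemma linear_h: "linear (h 0 u)"
  using bilinear_h by (simp add: bilinear_def)

lemma nil_proj_Z [simp]: "nil_proj (Z k) = 0"
  using span_Z derived by (metis (mono_tags) mem_Collect_eq rangeI span_base)

section \<open>Horizontal vectors and their lifts from the base\<close>

lemma horizontal_iff: "u \<in> horizontal C h \<longleftrightarrow> (\<forall>k. h 0 u (Z k) = 0)"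
proof -
  have "h 0 u z = 0" if "\<forall>k. h 0 u (Z k) = 0" "z \<in> derived_algebra C" for z
    using linear_eq_0_on_span[OF linear_h, of "range Z" u z] that span_Z by auto
  moreover have "Z k \<in> derived_algebra C" for k using derived by simp
  ultimately show ?thesis by (auto simp: horizontal_def)
qed

text \<open>The horizontal lift at the neutral element: the orthogonal projection onto the span of
  the orthonormal \<open>Z k\<close> is removed from an arbitrary preimage.\<close>

definition lift :: "real^'q \<Rightarrow> real^('q + 'p)"
  where "lift u = horiz_incl u - (\<Sum>k\<in>UNIV. h 0 (Z k) (horiz_incl u) *\<^sub>R Z k)"

lemma linear_lift: "linear lift"
  unfolding lift_def
  by (simp add: linear_iff linear_add[OF linear_horiz_incl] linear_cmul[OF linear_horiz_incl]
      linear_add[OF linear_h] linear_cmul[OF linear_h] scaleR_left_distrib sum.distrib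
      scaleR_right_diff_distrib scaleR_sum_right)

lemma nil_proj_lift [simp]: "nil_proj (lift u) = u"
  by (simp add: lift_def linear_diff[OF linear_nil_proj] linear_sum[OF linear_nil_proj]
      linear_cmul[OF linear_nil_proj])

lemma lift_horizontal: "lift u \<in> horizontal C h"
proof -
  have "h 0 (Z k) (lift u) = 0" for k
    by (simp add: lift_def linear_diff[OF linear_h] linear_sum[OF linear_h]
        linear_cmul[OF linear_h] ZZ if_distrib cong: if_cong)
  then show ?thesis by (simp add: horizontal_iff h_sym)
qed

text \<open>Two horizontal vectors with the same projection differ by a vertical vector that is also
  horizontal, so it is orthogonal to itself and vanishes.\<close>

lemma lift_nil_proj:
  assumes "u \<in> horizontal C h"
  shows "lift (nil_proj u) = u"
proof -
  let ?d = "lift (nil_proj u) - u"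
  have "?d \<in> derived_algebra C"
    by (simp add: derived linear_diff[OF linear_nil_proj])
  then have "h 0 ?d ?d = 0"
    using assms lift_horizontal[of "nil_proj u"]
    by (simp add: horizontal_def bilinear_lsub[OF bilinear_h])
  then show ?thesis using h_pos[of ?d] by fastforce
qed

lemma X_horizontal: "X i \<in> horizontal C h"
  by (simp add: horizontal_iff XZ)

text \<open>One inner product serves at every point of the base: left translations of the group act
  there as translations, so the induced metric is constant in this chart.\<close>

definition base_metric :: "real^'q \<Rightarrow> real^'q \<Rightarrow> real"
  where "base_metric u v = h 0 (lift u) (lift v)"

definition frame :: "'q \<Rightarrow> real^'q"
  where "frame i = nil_proj (X i)"

lemma lift_frame: "lift (frame i) = X i"
  by (simp add: frame_def lift_nil_proj X_horizontal)

lemma bilinear_base_metric: "bilinear base_metric"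
  by (auto simp: bilinear_def linear_iff base_metric_def linear_add[OF linear_lift]
      linear_cmul[OF linear_lift] bilinear_ladd[OF bilinear_h] bilinear_radd[OF bilinear_h]
      bilinear_lmul[OF bilinear_h] bilinear_rmul[OF bilinear_h])

lemma base_metric_frame: "base_metric (frame i) (frame j) = (if i = j then 1 else 0)"
  by (simp add: base_metric_def lift_frame XX)

lemma riemannian_base_metric: "riemannian_metric (\<lambda>x. base_metric)"
proof -
  have "u \<noteq> 0 \<Longrightarrow> lift u \<noteq> 0" for u
    by (metis nil_proj_lift linear_0[OF linear_nil_proj])
  then show ?thesis
    by (auto simp: riemannian_metric_def bilinear_base_metric smooth_const)
      (simp_all add: base_metric_def h_sym h_pos)
qed

section \<open>Coordinates in the orthonormal frame of the base, on which the matrices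
  \<open>B k\<close> act\<close>

definition coords :: "real^'q \<Rightarrow> real^'q"
  where "coords u = (\<chi> i. base_metric (frame i) u)"

definition combine :: "real^'q \<Rightarrow> real^'q"
  where "combine a = (\<Sum>i\<in>UNIV. a $ i *\<^sub>R frame i)"

lemma linear_coords: "linear coords"
  by (simp add: linear_iff coords_def vec_eq_iff bilinear_radd[OF bilinear_base_metric]
      bilinear_rmul[OF bilinear_base_metric])

lemma linear_combine: "linear combine"
  by (simp add: linear_iff combine_def scaleR_left_distrib sum.distrib scaleR_sum_right)

lemma combine_coords: "combine (coords u) = u"
  using orthonormal_expansion[OF bilinear_base_metric base_metric_frame]
  by (simp add: combine_def coords_def)

lemma linear_base_metric: "linear (base_metric u)"
  using bilinear_base_metric by (simp add: bilinear_def)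

lemma coords_combine: "coords (combine a) = a"
  by (simp add: coords_def combine_def vec_eq_iff linear_sum[OF linear_base_metric]
      linear_cmul[OF linear_base_metric] base_metric_frame if_distrib cong: if_cong)

lemma coords_frame: "coords (frame i) = e i"
  by (simp add: coords_def base_metric_frame axis_def vec_eq_iff eq_commute)

lemma bilinear_expand_frame:
  fixes T :: "real^'q \<Rightarrow> real^'q \<Rightarrow> real"
  assumes "bilinear T"
  shows "T u v = (\<Sum>i\<in>UNIV. \<Sum>j\<in>UNIV. coords u $ i * coords v $ j * T (frame i) (frame j))"
proof -
  have "T u v = T (combine (coords u)) (combine (coords v))"
    by (simp add: combine_coords)
  also have "\<dots> = (\<Sum>(i,j)\<in>UNIV \<times> UNIV. T (coords u $ i *\<^sub>R frame i) (coords v $ j *\<^sub>R frame j))"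
    unfolding combine_def by (rule bilinear_sum[OF assms])
  finally show ?thesis
    by (simp add: sum.cartesian_product bilinear_lmul[OF assms] bilinear_rmul[OF assms] mult_ac)
qed

lemma base_metric_coords: "base_metric u v = coords u \<bullet> coords v"
  by (subst bilinear_expand_frame[OF bilinear_base_metric])
    (simp add: base_metric_frame inner_vec_def if_distrib cong: if_cong)

text \<open>Pairing with the orthonormal \<open>Z k\<close> reads the entries of \<open>B k\<close>
  off the bracket, which is skew because \<open>C\<close> is.\<close>

lemma B_skew: "transpose (B k) = - B k"
proof -
  have Bk: "h 0 (Z k) (nil_bracket C (X i) (X j)) = B k $ i $ j" for i j
    by (simp add: bracket_X linear_sum[OF linear_h] linear_cmul[OF linear_h] ZZ if_distrib
        cong: if_cong)
  have "transpose (B k) $ i $ j = (- B k) $ i $ j" for i j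
    using Bk[of j i] Bk[of i j]
    by (simp add: nil_bracket_skew[OF C_skew, of "X j"] linear_neg[OF linear_h] transpose_def)
  then show ?thesis by (simp only: vec_eq_iff) simp
qed

section \<open>The connection and its curvature\<close>

text \<open>Minus the bracket, since \<open>d\<omega>(u,v) = -\<omega>([u,v])\<close> on left-invariant fields.\<close>

definition curv :: "real^'q \<Rightarrow> real^'q \<Rightarrow> real^'p"
  where "curv u v = - vert (nil_bracket C (lift u) (lift v))"

text \<open>The vector \<open>u\<close> at \<open>x\<close> is carried back to \<open>0\<close> by
  the inverse of the differential of left translation, giving \<open>u - [x,u]/2\<close>;
  subtracting the horizontal lift then leaves the vertical component.\<close>

definition conn :: "real^('q + 'p) \<Rightarrow> real^('q + 'p) \<Rightarrow> real^'p"
  where "conn x u = vert (u - lift (nil_proj u) - (1/2) *\<^sub>R nil_bracket C x u)"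

lemmas bracket_linear = bilinear_ladd[OF bilinear_nil_bracket] bilinear_radd[OF bilinear_nil_bracket]
  bilinear_lmul[OF bilinear_nil_bracket] bilinear_rmul[OF bilinear_nil_bracket]

lemma bilinear_curv: "bilinear curv"
  by (auto simp: bilinear_def linear_iff curv_def linear_add[OF linear_lift]
      linear_cmul[OF linear_lift] linear_add[OF linear_vert] linear_cmul[OF linear_vert]
      bracket_linear)

lemma linear_conn: "linear (conn x)"
  by (auto simp: linear_iff conn_def linear_add[OF linear_lift] linear_cmul[OF linear_lift]
      linear_add[OF linear_nil_proj] linear_cmul[OF linear_nil_proj]
      linear_add[OF linear_vert] linear_diff[OF linear_vert] linear_cmul[OF linear_vert]
      bracket_linear algebra_simps)

lemma connection_form_conn: "is_connection_form C h conn"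
proof -
  have "conn (nil_mult C a x) (ddir (nil_mult C a) x u) = conn x u" for a x u
  proof -
    have p: "nil_proj (u + (1/2) *\<^sub>R nil_bracket C a u) = nil_proj u"
      by (simp add: linear_add[OF linear_nil_proj] linear_cmul[OF linear_nil_proj])
    \<comment> \<open>The bracket does not see central summands. The extra \<open>[a,u]/2\<close> it
      yields in \<open>conn\<close> cancels the term added to \<open>u\<close> by the differential
      of the translation.\<close>
    have "nil_bracket C (nil_mult C a x) (u + (1/2) *\<^sub>R nil_bracket C a u)
        = nil_bracket C (a + x) u"
      by (rule nil_bracket_nil_proj_cong[OF _ p])
        (simp add: nil_proj_mult linear_add[OF linear_nil_proj])
    then show ?thesis
      by (simp add: conn_def ddir_nil_mult p bracket_linear scaleR_right_distrib algebra_simps)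
  qed
  moreover have "conn 0 u = 0" if "u \<in> horizontal C h" for u
    using that by (simp add: conn_def lift_nil_proj bilinear_lzero[OF bilinear_nil_bracket]
        linear_0[OF linear_vert])
  moreover have "conn 0 (incl w) = w" for w
    by (simp add: conn_def linear_0[OF linear_lift] bilinear_lzero[OF bilinear_nil_bracket])
  ultimately show ?thesis by (simp add: is_connection_form_def linear_conn)
qed

text \<open>\<open>conn\<close> is affine in the base point with slope minus half the bracket, and
  antisymmetrising doubles it. The result is constant and depends only on projections, so it
  descends.\<close>

lemma curvature_conn: "pullback2 nil_proj (\<lambda>x. curv) = ext_d1 conn"
proof (intro ext)
  fix x u v
  have D: "ddir (\<lambda>y. conn y v) x u = - (1/2) *\<^sub>R vert (nil_bracket C u v)" for u v
  proof -
    have "linear (\<lambda>y. vert ((1/2) *\<^sub>R nil_bracket C y v))"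
      by (simp add: linear_iff linear_add[OF linear_vert] linear_cmul[OF linear_vert] bracket_linear
          scaleR_right_distrib)
    then have "((\<lambda>y. vert ((1/2) *\<^sub>R nil_bracket C y v)) has_derivative
        (\<lambda>y. vert ((1/2) *\<^sub>R nil_bracket C y v))) (at x)"
      by (simp add: bounded_linear_imp_has_derivative linear_conv_bounded_linear)
    then have "((\<lambda>y. conn y v) has_derivative (\<lambda>y. - vert ((1/2) *\<^sub>R nil_bracket C y v))) (at x)"
      unfolding conn_def linear_diff[OF linear_vert] by (auto intro!: derivative_eq_intros)
    from fun_cong[OF frechet_derivative_at[OF this, symmetric]] show ?thesis
      by (simp add: linear_cmul[OF linear_vert])
  qed
  have half: "(1/2) *\<^sub>R w + (1/2) *\<^sub>R w = w" for w :: "real^'p"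
    by (metis scaleR_half_double scaleR_right_distrib)
  have "ext_d1 conn x u v = - vert (nil_bracket C u v)"
    using half
    by (simp add: ext_d1_def D nil_bracket_skew[OF C_skew, of v u] linear_neg[OF linear_vert]
        flip: minus_add_distrib)
  also have "\<dots> = curv (nil_proj u) (nil_proj v)"
    unfolding curv_def
    by (subst nil_bracket_nil_proj_cong[of u "lift (nil_proj u)" v "lift (nil_proj v)"]) simp_all
  finally show "pullback2 nil_proj (\<lambda>x. curv) x u v = ext_d1 conn x u v"
    by (simp add: pullback2_def ddir_linear[OF linear_nil_proj])
qed

text \<open>Left invariance moves the comparison to \<open>0\<close>; the differential of a
  translation preserves projections, and there lifting undoes projection on horizontal
  vectors.\<close>

lemma induced_base_metric: "is_induced_metric C h (\<lambda>x. base_metric)"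
proof -
  have "pullback2 nil_proj (\<lambda>x. base_metric) x (ddir (nil_mult C x) 0 u) (ddir (nil_mult C x) 0 v)
      = h x (ddir (nil_mult C x) 0 u) (ddir (nil_mult C x) 0 v)"
    if "u \<in> horizontal C h" "v \<in> horizontal C h" for x u v
  proof -
    have "pullback2 (nil_mult C x) h 0 u v = h 0 u v"
      using left_inv by (simp add: left_invariant_metric_def)
    then have "h x (ddir (nil_mult C x) 0 u) (ddir (nil_mult C x) 0 v) = h 0 u v"
      by (simp add: pullback2_def nil_mult_zero)
    moreover have "nil_proj (ddir (nil_mult C x) 0 w) = nil_proj w" for w
      by (simp add: ddir_nil_mult linear_add[OF linear_nil_proj] linear_cmul[OF linear_nil_proj])
    ultimately show ?thesis
      using that by (simp add: pullback2_def ddir_linear[OF linear_nil_proj] base_metric_def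
          lift_nil_proj)
  qed
  then show ?thesis by (auto simp: is_induced_metric_def riemannian_base_metric)
qed

lemma bilinear_fibre_ip: "bilinear (fibre_ip h)"
  by (auto simp: bilinear_def linear_iff fibre_ip_def linear_add[OF linear_incl]
      linear_cmul[OF linear_incl] bilinear_ladd[OF bilinear_h] bilinear_radd[OF bilinear_h]
      bilinear_lmul[OF bilinear_h] bilinear_rmul[OF bilinear_h])

lemma fibre_ip_vert_Z: "fibre_ip h (vert (Z k)) (vert (Z l)) = (if k = l then 1 else 0)"
  by (simp add: fibre_ip_def incl_vert ZZ)

text \<open>Lifts of the base frame are the \<open>X i\<close>, whose brackets have the entries of
  \<open>B k\<close> as components along \<open>Z k\<close>; bilinearity gives the rest.\<close>

lemma fibre_ip_curv: "fibre_ip h (vert (Z k)) (curv u v) = - (coords u \<bullet> (B k *v coords v))"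
proof -
  let ?T = "\<lambda>u v. h 0 (Z k) (nil_bracket C (lift u) (lift v))"
  have "bilinear ?T"
    by (auto simp: bilinear_def linear_iff linear_add[OF linear_lift] linear_cmul[OF linear_lift]
        bracket_linear linear_add[OF linear_h] linear_cmul[OF linear_h])
  moreover have "?T (frame i) (frame j) = B k $ i $ j" for i j
    by (simp add: lift_frame bracket_X linear_sum[OF linear_h] linear_cmul[OF linear_h] ZZ if_distrib
        cong: if_cong)
  ultimately have "?T u v = (\<Sum>i\<in>UNIV. \<Sum>j\<in>UNIV. coords u $ i * coords v $ j * B k $ i $ j)"
    by (subst bilinear_expand_frame) auto
  also have "\<dots> = coords u \<bullet> (B k *v coords v)"
    by (simp add: inner_vec_def matrix_vector_mult_def sum_distrib_left mult_ac)
  finally show ?thesis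
    by (simp add: fibre_ip_def curv_def incl_vert linear_neg[OF linear_incl] linear_neg[OF linear_h])
qed

text \<open>In the frames, the curvature components are entries of \<open>- B k *v coords u\<close>.
  The two signs cancel, and the factor one half compensates the two in
  \<open>inner_m_1\<close>.\<close>

lemma curvature_sq_curv:
  "curvature_sq (\<lambda>x. base_metric) (fibre_ip h) (\<lambda>x. curv) x u v
    = (1/2) * (coords u \<bullet> (m_1 B *v coords v))"
proof -
  have "curvature_sq (\<lambda>x. base_metric) (fibre_ip h) (\<lambda>x. curv) x u v
      = (\<Sum>i\<in>UNIV. \<Sum>k\<in>UNIV. (B k *v coords u) $ i * (B k *v coords v) $ i)"
    by (subst curvature_sq_orthonormal[OF bilinear_base_metric base_metric_frame
          bilinear_fibre_ip fibre_ip_vert_Z bilinear_curv])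
      (simp add: fibre_ip_curv coords_frame inner_axis')
  also have "\<dots> = (\<Sum>k\<in>UNIV. (B k *v coords u) \<bullet> (B k *v coords v))"
    by (subst sum.swap) (simp add: inner_vec_def)
  finally show ?thesis by (simp add: inner_m_1[OF B_skew])
qed

section \<open>The two soliton equations\<close>

theorem minimal_imp_ricci_yang_mills_soliton:
  assumes "minimal_point B"
  shows "ricci_yang_mills_soliton C h"
proof -
  \<comment> \<open>The factor 1/4 is forced: \<open>m_SL B\<close> is symmetric, so the Lie
    derivative of the metric doubles it, and the squared curvature contains \<open>m_1 B\<close>
    with factor 1/2.\<close>
  define Y where "Y u = combine ((1/4) *\<^sub>R (m_SL B *v coords u))" for u
  \<comment> \<open>Half of the scalar part that \<open>m_SL\<close> removes from
    \<open>m_1\<close>.\<close>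
  define c where "c = (1/2) * (1 / real CARD('q) * trace (m_1 B))"
  have Y: "linear Y"
    by (simp add: linear_iff Y_def linear_add[OF linear_coords] linear_cmul[OF linear_coords]
        linear_add[OF linear_combine] linear_cmul[OF linear_combine] matrix_vector_right_distrib
        matrix_vector_mult_scaleR scaleR_right_distrib)
  have coords_Y: "coords (Y u) = (1/4) *\<^sub>R (m_SL B *v coords u)" for u
    by (simp add: Y_def coords_combine)
  have sym: "(m_SL B *v a) \<bullet> b = a \<bullet> (m_SL B *v b)" for a b
    using dot_lmul_matrix[of a "m_SL B" b] transpose_matrix_vector[of "m_SL B" a]
    by (simp add: m_SL_symmetric[OF B_skew])
  have "curvature_sq (\<lambda>x. base_metric) (fibre_ip h) (\<lambda>x. curv) x u v
        - 2 * ricci (\<lambda>x. base_metric) x u v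
      = c * base_metric u v + lie_deriv Y (\<lambda>x. base_metric) x u v" for x u v
  proof -
    have "coords u \<bullet> (m_SL B *v coords v)
        = coords u \<bullet> (m_1 B *v coords v) - 2 * c * (coords u \<bullet> coords v)"
      by (simp add: m_SL_def c_def matrix_vector_mult_diff_rdistrib inner_diff_right
          scaleR_matrix_vector_assoc[symmetric])
    then show ?thesis
      by (simp add: curvature_sq_curv ricci_const lie_deriv_const[OF Y] base_metric_coords coords_Y sym
          field_simps)
  qed
  moreover have "curv (Y u) v + curv u (Y v) = 0" for u v
  proof -
    \<comment> \<open>Minimality enters here: every component of the Lie derivative of the curvature
      along the orthonormal fibre basis is a multiple of the expression in
      \<open>minimal_point_m_SL\<close>.\<close>
    have "fibre_ip h (vert (Z k)) (curv (Y u) v + curv u (Y v)) = 0" for k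
      using minimal_point_m_SL[OF B_skew assms, of "coords u" k "coords v"]
      by (simp add: bilinear_radd[OF bilinear_fibre_ip] fibre_ip_curv coords_Y
          matrix_vector_mult_scaleR)
    then show ?thesis
      using orthonormal_expansion[OF bilinear_fibre_ip fibre_ip_vert_Z, of "curv (Y u) v + curv u (Y v)"]
      by simp
  qed
  then have "hodge_laplacian2 (\<lambda>x. base_metric) (\<lambda>x. curv) = lie_deriv Y (\<lambda>x. curv)"
    by (intro ext) (simp add: hodge_laplacian2_const[OF bilinear_curv] lie_deriv_const[OF Y])
  ultimately show ?thesis
    unfolding ricci_yang_mills_soliton_def
    using connection_form_conn curvature_conn induced_base_metric smooth_linear[OF Y] by blast
qed

end

theorem corollary3p27:
  fixes C :: "'p::finite \<Rightarrow> real^'q^'q::finite"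
    and h :: "('q + 'p) metric"
  assumes "\<forall>k. transpose (C k) = - C k"
    and "inj C" and "independent (range C)"
    and "left_invariant_metric C h"
    and "ricci_soliton h"
    and "geodesic_flow_invariant C h"
  shows "ricci_yang_mills_soliton C h"
proof -
  obtain B where B: "structure_matrices C h B" "minimal_point B"
    using assms(6) by (auto simp: geodesic_flow_invariant_def)
  obtain X Z where
    "\<forall>i j. h 0 (X i) (X j) = (if i = j then 1 else 0)"
    "\<forall>k l. h 0 (Z k) (Z l) = (if k = l then 1 else 0)"
    "\<forall>i k. h 0 (X i) (Z k) = 0"
    "span (range Z) = derived_algebra C"
    "\<forall>i j. nil_bracket C (X i) (X j) = (\<Sum>k\<in>UNIV. B k $ i $ j *\<^sub>R Z k)"
    using B(1) unfolding structure_matrices_def by (elim exE conjE) (rule that)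
  \<comment> \<open>The frame is one realising the minimal tuple \<open>B\<close>, so no change of
    structure matrices is required.\<close>
  then have "adapted_frame C h X Z B"
    by (intro adapted_frame.intro assms(1,4) derived_algebra_eq(1)[OF assms(2,3)]) blast+
  then show ?thesis
    using B(2) by (rule adapted_frame.minimal_imp_ricci_yang_mills_soliton)
qed

end
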